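(* Let $A$ be an ordered combinatory algebra with an implication $\to$, an adjunctor $\mathrm e$ and a filter $\Phi$, and let $I$ be a set. Then for all $\varphi,\psi,\theta\in A^I$: $$\varphi\wedge\psi\vdash\theta\iff\varphi\vdash(\psi\to\theta).$$
   Context: An ordered combinatory algebra (OCA) is $(A,\circ,\le,\mathrm k,\mathrm s)$ with $A$ a set, $\circ:A\times A\to A$ a binary operation (application, $a\circ b=ab$, associating to the left), $\le$ a partial order on $A$, and $\mathrm k,\mathrm s\in A$, such that application is monotone in both arguments and $\mathrm kab\le a$, $\mathrm sabc\le ac(bc)$ for all $a,b,c\in A$. An implication is a map $\to:A\times A\to A$, monotone in the second variable and antimonotone in the first, such that $a\le(b\to c)$ implies $ab\le c$. An adjunctor is an element $\mathrm e\in A$ such that $ab\le c$ implies $\mathrm ea\le(b\to c)$. The OCA is classic if there is $\mathrm c\in A$ with $\mathrm c\le(((a\to b)\to a)\to a)$ for all $a,b$. A filter is a subset $\Phi\subseteq A$ closed under application, containing $\mathrm k$ and $\mathrm s$, containing $\mathrm e$ (when $A$ has an adjunctor $\mathrm e$), and containing $\mathrm c$ if $A$ is classic. Terms over $A$ are formal expressions built from elements of $A$ and variables by application. For a variable $y$ and term $t$, the term $\lambda^*y.t$ is defined recursively: $\lambda^*y.t=\mathrm kt$ if $y$ does not occur in $t$; $\lambda^*y.y=\mathrm{skk}$; otherwise $\lambda^*y.(tu)=\mathrm s(\lambda^*y.t)(\lambda^*y.u)$. Closed terms are evaluated in $A$. Put $p=\lambda^*x_1\lambda^*x_2\lambda^*x_3\,x_3x_1x_2\in\Phi$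 and $a\wedge b=pab$ for $a,b\in A$. $A^I$ is the set of functions $I\to A$, with pointwise operations $(\varphi\wedge\psi)(i)=\varphi(i)\wedge\psi(i)=p\varphi(i)\psi(i)$ and $(\varphi\to\psi)(i)=\varphi(i)\to\psi(i)$. The relation $\varphi\vdash\psi$ on $A^I$ means: there is $f\in\Phi$ such that $f\varphi(i)\le\psi(i)$ for all $i\in I$. *)

theory Defs
  imports Main "HOL-Library.FuncSet"
begin

text \<open>
  Ordered combinatory algebras are records with an explicit carrier; the operations are only
  constrained, and only used, on the carrier.
\<close>

record 'a oca =
  carrier :: "'a set"
  app :: "'a \<Rightarrow> 'a \<Rightarrow> 'a"  (infixl \<open>\<cdot>\<index>\<close> 75)
  leq :: "'a \<Rightarrow> 'a \<Rightarrow> bool"  (infix \<open>\<preceq>\<index>\<close> 50)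
  kk :: 'a  (\<open>\<k>\<index>\<close>)
  ss :: 'a  (\<open>\<s>\<index>\<close>)

locale ordered_combinatory_algebra =
  fixes A (structure)
  assumes app_closed: "\<lbrakk>a \<in> carrier A; b \<in> carrier A\<rbrakk> \<Longrightarrow> a \<cdot> b \<in> carrier A"
    and k_closed: "\<k> \<in> carrier A"
    and s_closed: "\<s> \<in> carrier A"
    and leq_refl: "reflp_on (carrier A) (\<preceq>)"
    and leq_antisym: "antisymp_on (carrier A) (\<preceq>)"
    and leq_trans: "transp_on (carrier A) (\<preceq>)"
    and app_mono_left:
      "\<lbrakk>a \<in> carrier A; a' \<in> carrier A; b \<in> carrier A; a \<preceq> a'\<rbrakk> \<Longrightarrow> a \<cdot> b \<preceq> a' \<cdot> b"
    and app_mono_right: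
      "\<lbrakk>a \<in> carrier A; b \<in> carrier A; b' \<in> carrier A; b \<preceq> b'\<rbrakk> \<Longrightarrow> a \<cdot> b \<preceq> a \<cdot> b'"
    and k_leq: "\<lbrakk>a \<in> carrier A; b \<in> carrier A\<rbrakk> \<Longrightarrow> \<k> \<cdot> a \<cdot> b \<preceq> a"
    and s_leq:
      "\<lbrakk>a \<in> carrier A; b \<in> carrier A; c \<in> carrier A\<rbrakk> \<Longrightarrow> \<s> \<cdot> a \<cdot> b \<cdot> c \<preceq> a \<cdot> c \<cdot> (b \<cdot> c)"

record 'a imp_oca = "'a oca" +
  imp :: "'a \<Rightarrow> 'a \<Rightarrow> 'a"  (infixr \<open>\<leadsto>\<index>\<close> 70)

locale implicative_oca = ordered_combinatory_algebra +
  assumes imp_closed: "\<lbrakk>a \<in> carrier A; b \<in> carrier A\<rbrakk> \<Longrightarrow> a \<leadsto> b \<in> carrier A"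
    and imp_antimono_left:
      "\<lbrakk>a \<in> carrier A; a' \<in> carrier A; b \<in> carrier A; a \<preceq> a'\<rbrakk> \<Longrightarrow> (a' \<leadsto> b) \<preceq> (a \<leadsto> b)"
    and imp_mono_right:
      "\<lbrakk>a \<in> carrier A; b \<in> carrier A; b' \<in> carrier A; b \<preceq> b'\<rbrakk> \<Longrightarrow> (a \<leadsto> b) \<preceq> (a \<leadsto> b')"
    and imp_elim:
      "\<lbrakk>a \<in> carrier A; b \<in> carrier A; c \<in> carrier A; a \<preceq> (b \<leadsto> c)\<rbrakk> \<Longrightarrow> a \<cdot> b \<preceq> c"

definition is_adjunctor :: "('a, 'm) imp_oca_scheme \<Rightarrow> 'a \<Rightarrow> bool" where
  "is_adjunctor A e \<longleftrightarrow> e \<in> carrier A \<and>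
     (\<forall>a\<in>carrier A. \<forall>b\<in>carrier A. \<forall>c\<in>carrier A.
        a \<cdot>\<^bsub>A\<^esub> b \<preceq>\<^bsub>A\<^esub> c \<longrightarrow> e \<cdot>\<^bsub>A\<^esub> a \<preceq>\<^bsub>A\<^esub> (b \<leadsto>\<^bsub>A\<^esub> c))"

definition is_peirce :: "('a, 'm) imp_oca_scheme \<Rightarrow> 'a \<Rightarrow> bool" where
  "is_peirce A c \<longleftrightarrow> c \<in> carrier A \<and>
     (\<forall>a\<in>carrier A. \<forall>b\<in>carrier A.
        c \<preceq>\<^bsub>A\<^esub> (((a \<leadsto>\<^bsub>A\<^esub> b) \<leadsto>\<^bsub>A\<^esub> a) \<leadsto>\<^bsub>A\<^esub> a))"

definition classic :: "('a, 'm) imp_oca_scheme \<Rightarrow> bool" where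
  "classic A \<longleftrightarrow> (\<exists>c. is_peirce A c)"

text \<open>
  Filters of an implicative OCA with given adjunctor \<open>e\<close>. As \<open>classic\<close> does not single out an
  element, a filter of a classic algebra is asked to contain one of the elements witnessing
  classicality.
\<close>

definition is_oca_filter :: "('a, 'm) imp_oca_scheme \<Rightarrow> 'a \<Rightarrow> 'a set \<Rightarrow> bool" where
  "is_oca_filter A e \<Phi> \<longleftrightarrow> \<Phi> \<subseteq> carrier A \<and>
     (\<forall>a\<in>\<Phi>. \<forall>b\<in>\<Phi>. a \<cdot>\<^bsub>A\<^esub> b \<in> \<Phi>) \<and>
     \<k>\<^bsub>A\<^esub> \<in> \<Phi> \<and> \<s>\<^bsub>A\<^esub> \<in> \<Phi> \<and> e \<in> \<Phi> \<and>
     (classic A \<longrightarrow> (\<exists>c\<in>\<Phi>. is_peirce A c))"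

datatype (consts_of: 'a, vars_of: 'v) ca_term =
  Con 'a
| Var 'v
| App "('a, 'v) ca_term" "('a, 'v) ca_term"

fun lam :: "('a, 'm) oca_scheme \<Rightarrow> 'v \<Rightarrow> ('a, 'v) ca_term \<Rightarrow> ('a, 'v) ca_term" where
  "lam A y (Con a) = App (Con \<k>\<^bsub>A\<^esub>) (Con a)"
| "lam A y (Var x) =
     (if x = y then App (App (Con \<s>\<^bsub>A\<^esub>) (Con \<k>\<^bsub>A\<^esub>)) (Con \<k>\<^bsub>A\<^esub>)
      else App (Con \<k>\<^bsub>A\<^esub>) (Var x))"
| "lam A y (App t u) =
     (if y \<in> vars_of (App t u) then App (App (Con \<s>\<^bsub>A\<^esub>) (lam A y t)) (lam A y u)
      else App (Con \<k>\<^bsub>A\<^esub>) (App t u))"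

text \<open>Evaluation is meaningful for closed terms only; the value on variables is arbitrary.\<close>

primrec eval_closed :: "('a, 'm) oca_scheme \<Rightarrow> ('a, 'v) ca_term \<Rightarrow> 'a" where
  "eval_closed A (Con a) = a"
| "eval_closed A (Var x) = undefined"
| "eval_closed A (App t u) = eval_closed A t \<cdot>\<^bsub>A\<^esub> eval_closed A u"

definition pairing :: "('a, 'm) oca_scheme \<Rightarrow> 'a" where
  "pairing A = eval_closed A
     (lam A (1::nat) (lam A 2 (lam A 3 (App (App (Var 3) (Var 1)) (Var 2)))))"

definition meet :: "('a, 'm) oca_scheme \<Rightarrow> 'a \<Rightarrow> 'a \<Rightarrow> 'a" where
  "meet A a b = pairing A \<cdot>\<^bsub>A\<^esub> a \<cdot>\<^bsub>A\<^esub> b"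

text \<open>
  \<open>A\<^sup>I\<close> is the set \<open>I \<rightarrow>\<^sub>E carrier A\<close> of functions that are undefined outside \<open>I\<close>; the pointwise
  operations are restricted to \<open>I\<close> accordingly.
\<close>

definition pred_meet ::
  "('a, 'm) oca_scheme \<Rightarrow> 'i set \<Rightarrow> ('i \<Rightarrow> 'a) \<Rightarrow> ('i \<Rightarrow> 'a) \<Rightarrow> 'i \<Rightarrow> 'a" where
  "pred_meet A I \<phi> \<psi> = (\<lambda>i\<in>I. meet A (\<phi> i) (\<psi> i))"

definition pred_imp ::
  "('a, 'm) imp_oca_scheme \<Rightarrow> 'i set \<Rightarrow> ('i \<Rightarrow> 'a) \<Rightarrow> ('i \<Rightarrow> 'a) \<Rightarrow> 'i \<Rightarrow> 'a" where
  "pred_imp A I \<phi> \<psi> = (\<lambda>i\<in>I. \<phi> i \<leadsto>\<^bsub>A\<^esub> \<psi> i)"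

definition entails ::
  "('a, 'm) oca_scheme \<Rightarrow> 'a set \<Rightarrow> 'i set \<Rightarrow> ('i \<Rightarrow> 'a) \<Rightarrow> ('i \<Rightarrow> 'a) \<Rightarrow> bool" where
  "entails A \<Phi> I \<phi> \<psi> \<longleftrightarrow> (\<exists>f\<in>\<Phi>. \<forall>i\<in>I. f \<cdot>\<^bsub>A\<^esub> \<phi> i \<preceq>\<^bsub>A\<^esub> \<psi> i)"

end

theory Submission
  imports Defs
begin

text \<open>
  Both directions rest on combinatory completeness: abstraction satisfies the inequality
  \<open>(\<lambda>\<^sup>*y.t) a \<preceq> t[a/y]\<close> (lemma \<open>lam_beta\<close>), and a closed term whose constants lie in the
  filter has its value in the filter. So a realizer may be written as a lambda term over the
  given ones, and only its reduction has to be checked.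

  If \<open>f\<close> realizes \<open>\<phi> \<and> \<psi> \<turnstile> \<theta>\<close>, then \<open>\<lambda>\<^sup>*x. e (\<lambda>\<^sup>*y. f (p x y))\<close> realizes \<open>\<phi> \<turnstile> \<psi> \<rightarrow> \<theta>\<close>:
  at arguments \<open>a\<close>, \<open>b\<close> the inner abstraction applied to \<open>b\<close> lies below \<open>f (p a b)\<close>, hence below the
  value of \<open>\<theta>\<close>, and the adjunctor carries this bound over to the implication. Conversely, if
  \<open>f\<close> realizes \<open>\<phi> \<turnstile> \<psi> \<rightarrow> \<theta>\<close>, then \<open>\<lambda>\<^sup>*z. z f\<close> realizes \<open>\<phi> \<and> \<psi> \<turnstile> \<theta>\<close>, because a pair applied to
  \<open>f\<close> passes its two components to \<open>f\<close>, that is \<open>p a b f \<preceq> f a b\<close>.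
\<close>

primrec subst :: "'v \<Rightarrow> 'a \<Rightarrow> ('a, 'v) ca_term \<Rightarrow> ('a, 'v) ca_term" where
  "subst y a (Con b) = Con b"
| "subst y a (Var x) = (if x = y then Con a else Var x)"
| "subst y a (App t u) = App (subst y a t) (subst y a u)"

lemma subst_fresh: "y \<notin> vars_of t \<Longrightarrow> subst y a t = t"
  by (induction t) auto

lemma vars_of_subst: "vars_of (subst y a t) = vars_of t - {y}"
  by (induction t) auto

lemma vars_of_lam: "vars_of (lam A y t) = vars_of t - {y}"
  by (induction t) auto

lemma consts_of_lam: "consts_of (lam A y t) \<subseteq> consts_of t \<union> {\<k>\<^bsub>A\<^esub>, \<s>\<^bsub>A\<^esub>}"
  by (induction t) auto

text \<open>
  Substituting a constant for \<open>x\<close> leaves the occurrences of \<open>y\<close> unchanged, so each clause of the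
  abstraction algorithm applies after the substitution exactly when it did before. This gives an
  equality of terms, and nested abstractions can therefore be reduced from the outside inwards.
\<close>

lemma subst_lam: "x \<noteq> y \<Longrightarrow> subst x a (lam A y t) = lam A y (subst x a t)"
  by (induction t) (auto simp: vars_of_subst)

lemma eval_closed_in:
  assumes "\<And>a b. \<lbrakk>a \<in> X; b \<in> X\<rbrakk> \<Longrightarrow> a \<cdot>\<^bsub>A\<^esub> b \<in> X"
    and "consts_of t \<subseteq> X" "vars_of t = {}"
  shows "eval_closed A t \<in> X"
  using assms(2,3) by (induction t) (auto intro: assms(1))

lemma (in ordered_combinatory_algebra) leq_transD:
  "\<lbrakk>a \<preceq> b; b \<preceq> c; a \<in> carrier A; b \<in> carrier A; c \<in> carrier A\<rbrakk> \<Longrightarrow> a \<preceq> c"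
  using leq_trans by (blast dest: transp_onD)

lemma (in ordered_combinatory_algebra) app_mono:
  assumes "a \<preceq> a'" "b \<preceq> b'"
    and "a \<in> carrier A" "a' \<in> carrier A" "b \<in> carrier A" "b' \<in> carrier A"
  shows "a \<cdot> b \<preceq> a' \<cdot> b'"
  using assms
  by (blast intro: leq_transD[of _ "a' \<cdot> b"] app_mono_left app_mono_right app_closed)

lemma (in ordered_combinatory_algebra) eval_closed_carrier:
  "\<lbrakk>consts_of t \<subseteq> carrier A; vars_of t = {}\<rbrakk> \<Longrightarrow> eval_closed A t \<in> carrier A"
  by (rule eval_closed_in) (auto intro: app_closed)

lemma (in ordered_combinatory_algebra) consts_of_lam_carrier:
  "consts_of t \<subseteq> carrier A \<Longrightarrow> consts_of (lam A y t) \<subseteq> carrier A"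
  using consts_of_lam[of A y t] k_closed s_closed by auto

lemma (in ordered_combinatory_algebra) skk_leq:
  assumes "a \<in> carrier A"
  shows "\<s> \<cdot> \<k> \<cdot> \<k> \<cdot> a \<preceq> a"
  using assms
  by (blast intro: leq_transD[OF s_leq k_leq] app_closed k_closed s_closed)

text \<open>
  If \<open>y\<close> occurs in an application, \<open>\<s>\<close> passes the argument on to both parts and monotonicity of
  application combines the two induction hypotheses. Nothing but \<open>y\<close> may be free in \<open>t\<close>, because
  only then both sides evaluate closed terms.
\<close>

lemma (in ordered_combinatory_algebra) lam_beta:
  assumes "a \<in> carrier A"
  shows "consts_of t \<subseteq> carrier A \<Longrightarrow> vars_of t \<subseteq> {y} \<Longrightarrow>
    eval_closed A (lam A y t) \<cdot> a \<preceq> eval_closed A (subst y a t)"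
proof (induction t)
  case (Con b)
  then show ?case using assms by (simp add: k_leq)
next
  case (Var x)
  then show ?case using assms by (simp add: skk_leq)
next
  case (App t u)
  show ?case
  proof (cases "y \<in> vars_of (App t u)")
    case False
    with App.prems have "eval_closed A (App t u) \<in> carrier A"
      by (intro eval_closed_carrier) auto
    with False assms show ?thesis by (simp add: k_leq subst_fresh)
  next
    case True
    let ?t = "eval_closed A (lam A y t)" and ?u = "eval_closed A (lam A y u)"
    have lams: "?t \<in> carrier A" "?u \<in> carrier A"
      using App.prems by (auto intro!: eval_closed_carrier consts_of_lam_carrier simp: vars_of_lam)
    have "consts_of (subst y a v) \<subseteq> insert a (consts_of v)" for v
      by (induction v) auto
    then have substs:
      "eval_closed A (subst y a t) \<in> carrier A" "eval_closed A (subst y a u) \<in> carrier A"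
      using App.prems assms by (fastforce intro!: eval_closed_carrier simp: vars_of_subst)+
    have "\<s> \<cdot> ?t \<cdot> ?u \<cdot> a \<preceq> ?t \<cdot> a \<cdot> (?u \<cdot> a)"
      using lams assms by (rule s_leq)
    moreover have
      "?t \<cdot> a \<cdot> (?u \<cdot> a) \<preceq> eval_closed A (subst y a t) \<cdot> eval_closed A (subst y a u)"
      using App lams substs assms by (intro app_mono) (auto intro: app_closed)
    ultimately have
      "\<s> \<cdot> ?t \<cdot> ?u \<cdot> a \<preceq> eval_closed A (subst y a t) \<cdot> eval_closed A (subst y a u)"
      by (rule leq_transD) (use lams substs assms in \<open>auto intro!: app_closed s_closed\<close>)
    with True show ?thesis by simp
  qed
qed

lemma (in ordered_combinatory_algebra) pairing_carrier: "pairing A \<in> carrier A"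
  unfolding pairing_def
  by (intro eval_closed_carrier consts_of_lam_carrier) (auto simp: vars_of_lam)

lemma (in ordered_combinatory_algebra) pairing_leq:
  assumes a: "a \<in> carrier A" and b: "b \<in> carrier A" and c: "c \<in> carrier A"
  shows "pairing A \<cdot> a \<cdot> b \<cdot> c \<preceq> c \<cdot> a \<cdot> b"
proof -
  define t1 where "t1 = lam A (2::nat) (lam A 3 (App (App (Var 3) (Con a)) (Var 2)))"
  define t2 where "t2 = lam A (3::nat) (App (App (Var 3) (Con a)) (Con b))"
  have t1: "eval_closed A t1 \<in> carrier A" and t2: "eval_closed A t2 \<in> carrier A"
    unfolding t1_def t2_def using a b
    by (intro eval_closed_carrier consts_of_lam_carrier; auto simp: vars_of_lam)+
  have "pairing A \<cdot> a \<preceq>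
      eval_closed A (subst 1 a (lam A (2::nat) (lam A 3 (App (App (Var 3) (Var 1)) (Var 2)))))"
    unfolding pairing_def
    by (intro lam_beta consts_of_lam_carrier) (auto simp: vars_of_lam a)
  then have 1: "pairing A \<cdot> a \<preceq> eval_closed A t1"
    by (simp add: t1_def subst_lam del: lam.simps)
  have "eval_closed A t1 \<cdot> b \<preceq>
      eval_closed A (subst 2 b (lam A (3::nat) (App (App (Var 3) (Con a)) (Var 2))))"
    unfolding t1_def using a b
    by (intro lam_beta consts_of_lam_carrier) (auto simp: vars_of_lam)
  then have 2: "eval_closed A t1 \<cdot> b \<preceq> eval_closed A t2"
    by (simp add: t2_def subst_lam del: lam.simps)
  have "eval_closed A t2 \<cdot> c \<preceq>
      eval_closed A (subst 3 c (App (App (Var (3::nat)) (Con a)) (Con b)))"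
    unfolding t2_def using a b c by (intro lam_beta) auto
  then have 3: "eval_closed A t2 \<cdot> c \<preceq> c \<cdot> a \<cdot> b"
    by simp
  note closed = a b c t1 t2 pairing_carrier app_closed
  have 4: "pairing A \<cdot> a \<cdot> b \<preceq> eval_closed A t2"
    by (rule leq_transD[OF app_mono_left[OF _ _ _ 1] 2]) (intro closed)+
  show ?thesis
    by (rule leq_transD[OF app_mono_left[OF _ _ _ 4] 3]) (intro closed)+
qed

lemma filter_eval_lam:
  assumes "is_oca_filter A e \<Phi>" "consts_of t \<subseteq> \<Phi>" "vars_of t \<subseteq> {y}"
  shows "eval_closed A (lam A y t) \<in> \<Phi>"
proof (rule eval_closed_in)
  show "consts_of (lam A y t) \<subseteq> \<Phi>"
    using assms consts_of_lam[of A y t] by (auto simp: is_oca_filter_def)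
qed (use assms in \<open>auto simp: is_oca_filter_def vars_of_lam\<close>)

lemma pairing_in_filter:
  assumes "is_oca_filter A e \<Phi>"
  shows "pairing A \<in> \<Phi>"
  unfolding pairing_def
proof (rule filter_eval_lam[OF assms])
  let ?t = "App (App (Var 3) (Var 1)) (Var 2) :: ('a, nat) ca_term"
  show "consts_of (lam A 2 (lam A 3 ?t)) \<subseteq> \<Phi>"
    using consts_of_lam[of A 2 "lam A 3 ?t"] consts_of_lam[of A 3 ?t] assms
    by (auto simp: is_oca_filter_def)
qed (auto simp: vars_of_lam)

text \<open>
  The two lemmas below convert realizers. The new realizer is chosen before \<open>a\<close>, \<open>b\<close> and \<open>c\<close>,
  so that it works at all indices of a family at once.
\<close>

lemma (in implicative_oca) curry_realizer:
  assumes e: "is_adjunctor A e" and \<Phi>: "is_oca_filter A e \<Phi>" and f: "f \<in> \<Phi>"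
  obtains g where "g \<in> \<Phi>"
    and "\<And>a b c. \<lbrakk>a \<in> carrier A; b \<in> carrier A; c \<in> carrier A; f \<cdot> meet A a b \<preceq> c\<rbrakk>
      \<Longrightarrow> g \<cdot> a \<preceq> (b \<leadsto> c)"
proof
  \<comment> \<open>The inner abstraction \<open>\<lambda>\<^sup>*y. f (p t y)\<close>, with \<open>t\<close> first the outer variable, then its value.\<close>
  define body where
    "body t = lam A (2::nat) (App (Con f) (App (App (Con (pairing A)) t) (Var 2)))" for t
  define g where "g = eval_closed A (lam A 1 (App (Con e) (body (Var 1))))"
  have sub: "\<Phi> \<subseteq> carrier A" and eks: "e \<in> \<Phi>" "\<k> \<in> \<Phi>" "\<s> \<in> \<Phi>"
    using \<Phi> by (auto simp: is_oca_filter_def)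
  have body_consts: "consts_of (body (Var 1)) \<subseteq> \<Phi>"
    using consts_of_lam[of A "2::nat"
        "App (Con f) (App (App (Con (pairing A)) (Var 1)) (Var 2))"]
      f eks pairing_in_filter[OF \<Phi>] by (auto simp: body_def)
  have body_vars: "vars_of (body (Var 1)) = {1}"
    by (auto simp: body_def vars_of_lam simp del: lam.simps)
  show "g \<in> \<Phi>"
    unfolding g_def using body_consts body_vars eks by (intro filter_eval_lam[OF \<Phi>]) auto
  fix a b c
  assume a: "a \<in> carrier A" and b: "b \<in> carrier A" and c: "c \<in> carrier A"
    and le: "f \<cdot> meet A a b \<preceq> c"
  let ?h = "eval_closed A (body (Con a))"
  have h: "?h \<in> carrier A"
    unfolding body_def using a f sub pairing_carrier
    by (intro eval_closed_carrier consts_of_lam_carrier) (auto simp: vars_of_lam)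
  have "g \<cdot> a \<preceq> eval_closed A (subst 1 a (App (Con e) (body (Var 1))))"
    unfolding g_def using a body_consts body_vars eks sub by (intro lam_beta) auto
  then have ga: "g \<cdot> a \<preceq> e \<cdot> ?h"
    by (simp add: body_def subst_lam del: lam.simps)
  have "?h \<cdot> b \<preceq>
      eval_closed A
        (subst 2 b (App (Con f) (App (App (Con (pairing A)) (Con a)) (Var (2::nat)))))"
    unfolding body_def using a b f sub pairing_carrier by (intro lam_beta) auto
  then have "?h \<cdot> b \<preceq> f \<cdot> meet A a b"
    by (simp add: meet_def)
  then have "?h \<cdot> b \<preceq> c"
    using le by (rule leq_transD)
      (use a b c f h sub pairing_carrier in \<open>auto simp: meet_def intro!: app_closed\<close>)
  with e h b c have "e \<cdot> ?h \<preceq> (b \<leadsto> c)"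
    by (auto simp: is_adjunctor_def)
  with ga show "g \<cdot> a \<preceq> (b \<leadsto> c)"
    by (rule leq_transD)
      (use \<open>g \<in> \<Phi>\<close> eks sub a b c h in \<open>auto intro!: app_closed imp_closed\<close>)
qed

lemma (in implicative_oca) uncurry_realizer:
  assumes \<Phi>: "is_oca_filter A e \<Phi>" and f: "f \<in> \<Phi>"
  obtains g where "g \<in> \<Phi>"
    and "\<And>a b c. \<lbrakk>a \<in> carrier A; b \<in> carrier A; c \<in> carrier A; f \<cdot> a \<preceq> (b \<leadsto> c)\<rbrakk>
      \<Longrightarrow> g \<cdot> meet A a b \<preceq> c"
proof
  define g where "g = eval_closed A (lam A () (App (Var ()) (Con f)))"
  have f': "f \<in> carrier A" using f \<Phi> by (auto simp: is_oca_filter_def)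
  show "g \<in> \<Phi>"
    unfolding g_def using f by (intro filter_eval_lam[OF \<Phi>]) auto
  then have g: "g \<in> carrier A" using \<Phi> by (auto simp: is_oca_filter_def)
  fix a b c
  assume a: "a \<in> carrier A" and b: "b \<in> carrier A" and c: "c \<in> carrier A"
    and le: "f \<cdot> a \<preceq> (b \<leadsto> c)"
  have m: "meet A a b \<in> carrier A"
    using a b by (auto simp: meet_def intro!: app_closed pairing_carrier)
  have "g \<cdot> meet A a b \<preceq> eval_closed A (subst () (meet A a b) (App (Var ()) (Con f)))"
    unfolding g_def using m f' by (intro lam_beta) auto
  then have "g \<cdot> meet A a b \<preceq> meet A a b \<cdot> f"
    by simp
  moreover have "meet A a b \<cdot> f \<preceq> f \<cdot> a \<cdot> b"
    unfolding meet_def using a b f' by (rule pairing_leq)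
  moreover have "f \<cdot> a \<cdot> b \<preceq> c"
    using a b c f' le by (auto intro: imp_elim app_closed)
  ultimately show "g \<cdot> meet A a b \<preceq> c"
    using a b c f' g m by (meson leq_transD app_closed)
qed

theorem theorem8p2:
  fixes A :: "'a imp_oca" and e :: 'a and \<Phi> :: "'a set" and I :: "'i set"
    and \<phi> \<psi> \<theta> :: "'i \<Rightarrow> 'a"
  assumes "implicative_oca A"
    and "is_adjunctor A e"
    and "is_oca_filter A e \<Phi>"
    and "\<phi> \<in> I \<rightarrow>\<^sub>E carrier A"
    and "\<psi> \<in> I \<rightarrow>\<^sub>E carrier A"
    and "\<theta> \<in> I \<rightarrow>\<^sub>E carrier A"
  shows "entails A \<Phi> I (pred_meet A I \<phi> \<psi>) \<theta> \<longleftrightarrow> entails A \<Phi> I \<phi> (pred_imp A I \<psi> \<theta>)"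
proof -
  interpret implicative_oca A by fact
  have mem: "\<phi> i \<in> carrier A" "\<psi> i \<in> carrier A" "\<theta> i \<in> carrier A" if "i \<in> I" for i
    using assms(4-6) that by (auto dest: PiE_mem)
  show ?thesis
  proof
    assume "entails A \<Phi> I (pred_meet A I \<phi> \<psi>) \<theta>"
    then obtain f where f: "f \<in> \<Phi>"
      and le: "\<And>i. i \<in> I \<Longrightarrow> f \<cdot>\<^bsub>A\<^esub> meet A (\<phi> i) (\<psi> i) \<preceq>\<^bsub>A\<^esub> \<theta> i"
      by (auto simp: entails_def pred_meet_def)
    obtain g where "g \<in> \<Phi>" and g:
      "\<And>a b c. \<lbrakk>a \<in> carrier A; b \<in> carrier A; c \<in> carrier A; f \<cdot>\<^bsub>A\<^esub> meet A a b \<preceq>\<^bsub>A\<^esub> c\<rbrakk>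
        \<Longrightarrow> g \<cdot>\<^bsub>A\<^esub> a \<preceq>\<^bsub>A\<^esub> (b \<leadsto>\<^bsub>A\<^esub> c)"
      using curry_realizer[OF assms(2,3) f] by metis
    then show "entails A \<Phi> I \<phi> (pred_imp A I \<psi> \<theta>)"
      using le mem by (auto simp: entails_def pred_imp_def intro!: bexI[of _ g] g)
  next
    assume "entails A \<Phi> I \<phi> (pred_imp A I \<psi> \<theta>)"
    then obtain f where f: "f \<in> \<Phi>"
      and le: "\<And>i. i \<in> I \<Longrightarrow> f \<cdot>\<^bsub>A\<^esub> \<phi> i \<preceq>\<^bsub>A\<^esub> (\<psi> i \<leadsto>\<^bsub>A\<^esub> \<theta> i)"
      by (auto simp: entails_def pred_imp_def)
    obtain g where "g \<in> \<Phi>" and g: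
      "\<And>a b c. \<lbrakk>a \<in> carrier A; b \<in> carrier A; c \<in> carrier A; f \<cdot>\<^bsub>A\<^esub> a \<preceq>\<^bsub>A\<^esub> (b \<leadsto>\<^bsub>A\<^esub> c)\<rbrakk>
        \<Longrightarrow> g \<cdot>\<^bsub>A\<^esub> meet A a b \<preceq>\<^bsub>A\<^esub> c"
      using uncurry_realizer[OF assms(3) f] by metis
    then show "entails A \<Phi> I (pred_meet A I \<phi> \<psi>) \<theta>"
      using le mem by (auto simp: entails_def pred_meet_def intro!: bexI[of _ g] g)
  qed
qed

end
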